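(* Let $k\geq 1$ be an integer and let $Q$ be a finite set of intervals. Let $Gr_Q$ be the sequence of intervals obtained by listing the elements of $Q$ in increasing order of their right endpoints, where among intervals with equal right endpoints those with smaller left endpoint are listed first. Then $$k\text{-wd}(Q)=k\text{-wd}(Gr_Q).$$
   Context: Intervals are closed real intervals $[a,b]$ with $a<b$. The (strict) partial order on intervals is: $[a_1,b_1]$ is below $[a_2,b_2]$ if and only if $b_1\leq a_2$. A rooted tree is $k$-ary if every node has at most $k$ children. A $k$-ary chain of a poset is a subset $A$ of its elements for which there exist a $k$-ary rooted tree $T$ and a bijection between $A$ and the vertices of $T$ such that whenever $v$ is a (proper) descendant of $u$ in $T$, $u<v$ in the poset. The $k$-width $k\text{-wd}$ of a finite poset is the smallest number of classes in a partition of the poset into $k$-ary chains. A finite set of intervals $Q$ is regarded as a poset under the order above, and $k\text{-wd}(Q)$ is the $k$-width of this poset. A sequence of intervals $S=(I_1,\ldots,I_n)$ is identified with the poset on $\{(i,I_i):1\leq i\leq n\}$ in which $(i,I_i)<(j,I_j)$ if and only if $i<j$ and $I_i$ is below $I_j$; $k\text{-wd}(S)$ is the $k$-width of that poset. *)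

theory Defs
  imports Complex_Main "HOL-Library.Disjoint_Sets" "HOL-Library.Interval"
begin

text \<open>
  A rooted tree with vertex set \<open>V\<close> and root \<open>r\<close>; \<open>(u, v) \<in> E\<close> means that \<open>v\<close> is a child of
  \<open>u\<close>, so that \<open>(u, v) \<in> E\<^sup>+\<close> means that \<open>v\<close> is a proper descendant of \<open>u\<close>.
\<close>

definition rooted_tree :: "'a set \<Rightarrow> 'a \<Rightarrow> ('a \<times> 'a) set \<Rightarrow> bool" where
  "rooted_tree V r E \<longleftrightarrow>
     r \<in> V \<and> E \<subseteq> V \<times> V \<and>
     (\<forall>u. (u, r) \<notin> E) \<and>
     (\<forall>v\<in>V - {r}. \<exists>!u. (u, v) \<in> E) \<and>
     (\<forall>v\<in>V. (r, v) \<in> E\<^sup>*)"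

definition kary_tree :: "nat \<Rightarrow> 'a set \<Rightarrow> 'a \<Rightarrow> ('a \<times> 'a) set \<Rightarrow> bool" where
  "kary_tree k V r E \<longleftrightarrow>
     rooted_tree V r E \<and> (\<forall>u\<in>V. finite (E `` {u}) \<and> card (E `` {u}) \<le> k)"

text \<open>
  Vertices are taken from the type of the elements of \<open>A\<close>; this loses nothing, because a tree
  can be renamed along its bijection with \<open>A\<close>.
\<close>

definition kary_chain :: "nat \<Rightarrow> ('a \<Rightarrow> 'a \<Rightarrow> bool) \<Rightarrow> 'a set \<Rightarrow> bool" where
  "kary_chain k lt A \<longleftrightarrow>
     (\<exists>(V :: 'a set) r E f. kary_tree k V r E \<and> bij_betw f V A \<and>
        (\<forall>u v. (u, v) \<in> E\<^sup>+ \<longrightarrow> lt (f u) (f v)))"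

text \<open>The poset is given by its (finite) carrier \<open>P\<close> and its strict order \<open>lt\<close>.\<close>

definition k_width :: "nat \<Rightarrow> 'a set \<Rightarrow> ('a \<Rightarrow> 'a \<Rightarrow> bool) \<Rightarrow> nat" where
  "k_width k P lt =
     (LEAST n. \<exists>C. partition_on P C \<and> (\<forall>A\<in>C. kary_chain k lt A) \<and> card C = n)"

text \<open>
  The relation \<open><\<close> that the library puts on the type of intervals is strict inclusion, so
  the order on intervals needs a name of its own. The library type also contains the degenerate
  intervals \<open>[a, a]\<close>, for which \<open>below\<close> would be reflexive; they have to be excluded by a hypothesis.
\<close>

definition below :: "real interval \<Rightarrow> real interval \<Rightarrow> bool" where
  "below I J \<longleftrightarrow> upper I \<le> lower J"

definition seq_elems :: "'a list \<Rightarrow> (nat \<times> 'a) set" where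
  "seq_elems S = {(i, S ! i) | i. i < length S}"

definition seq_below :: "nat \<times> real interval \<Rightarrow> nat \<times> real interval \<Rightarrow> bool" where
  "seq_below = (\<lambda>(i, I) (j, J). i < j \<and> below I J)"

definition endpoint_less :: "real interval \<Rightarrow> real interval \<Rightarrow> bool" where
  "endpoint_less I J \<longleftrightarrow> upper I < upper J \<or> upper I = upper J \<and> lower I < lower J"

definition Gr :: "real interval set \<Rightarrow> real interval list" where
  "Gr Q = (THE S. set S = Q \<and> sorted_wrt endpoint_less S)"

lemma below_strict_order:
  assumes "\<forall>I\<in>Q. lower I < upper I"
  shows "\<forall>I\<in>Q. \<not> below I I"
    and "\<forall>I\<in>Q. \<forall>J\<in>Q. \<forall>K\<in>Q. below I J \<longrightarrow> below J K \<longrightarrow> below I K"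
  using assms by (fastforce simp: below_def)+

lemma kary_chain_singleton: "kary_chain k lt {a}"
  unfolding kary_chain_def kary_tree_def rooted_tree_def
  by (rule exI[of _ "{a}"], rule exI[of _ a], rule exI[of _ "{}"], rule exI[of _ id]) auto

lemma k_width_attained:
  obtains C where "partition_on P C" "\<forall>A\<in>C. kary_chain k lt A" "card C = k_width k P lt"
proof -
  let ?C = "(\<lambda>x. {x}) ` P"
  have "partition_on P ?C"
    by (auto simp: partition_on_def disjoint_def)
  moreover have "\<forall>A\<in>?C. kary_chain k lt A"
    by (auto simp: kary_chain_singleton)
  ultimately have "\<exists>n C. partition_on P C \<and> (\<forall>A\<in>C. kary_chain k lt A) \<and> card C = n"
    by blast
  from LeastI_ex[OF this] show thesis
    using that unfolding k_width_def by blast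
qed

lemma Gr_ex1:
  assumes "finite Q"
  shows "\<exists>!S. set S = Q \<and> sorted_wrt endpoint_less S"
proof -
  let ?le = "\<lambda>I J. endpoint_less I J \<or> I = J"
  interpret el: linorder ?le endpoint_less
    by unfold_locales (auto simp: endpoint_less_def interval_eq_iff)
  show ?thesis
    using el.finite_sorted_distinct_unique[OF assms] by (simp add: el.strict_sorted_iff)
qed

lemma Gr_properties:
  assumes "finite Q"
  shows "set (Gr Q) = Q" "sorted_wrt endpoint_less (Gr Q)"
  using theI'[OF Gr_ex1[OF assms]] unfolding Gr_def by blast+

end

theory Submission
  imports Defs
begin

text \<open>
  If \<open>I\<close> is below \<open>J\<close>, then the right endpoint of \<open>I\<close> is at most the left endpoint of \<open>J\<close>, hence
  less than the right endpoint of \<open>J\<close>, so \<open>I\<close> precedes \<open>J\<close> in the list. The condition \<open>i < j\<close> in the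
  order of the sequence is therefore redundant, and forgetting the positions is an isomorphism
  of posets; the \<open>k\<close>-width is invariant under isomorphism.
\<close>

text \<open>Descendants in the relabelled tree must come from descendants in the original, so that
  order facts can be pulled back. Two consecutive image edges meet at \<open>g v = g v'\<close>;
  injectivity on \<open>V\<close> identifies the two preimages, so the lifted edges
  concatenate.\<close>

lemma trancl_map_prod_image:
  assumes "inj_on g V" "E \<subseteq> V \<times> V" "(x, y) \<in> (map_prod g g ` E)\<^sup>+"
  shows "\<exists>u v. x = g u \<and> y = g v \<and> (u, v) \<in> E\<^sup>+"
  using assms(3)
proof (induction rule: trancl_induct)
  case (base y)
  then show ?case by auto
next
  case (step y z)
  then obtain u v v' w where uv: "x = g u" "y = g v" "(u, v) \<in> E\<^sup>+"
    and vw: "y = g v'" "z = g w" "(v', w) \<in> E"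
    by auto
  have "v \<in> V"
    using uv(3) trancl_subset_Sigma[OF assms(2)] by blast
  moreover have "v' \<in> V"
    using vw(3) assms(2) by blast
  ultimately have "v' = v"
    using inj_onD[OF assms(1)] uv(2) vw(1) by simp
  then have "(u, w) \<in> E\<^sup>+"
    using uv(3) vw(3) by (simp add: trancl_into_trancl)
  then show ?case
    using uv(1) vw(2) by blast
qed

text \<open>Injectivity ensures that an edge into \<open>g v\<close> can only come from an edge into
  \<open>v\<close>, which keeps the root parentless and the parents unique. Reachability passes
  along \<open>g\<close> edge by edge.\<close>

lemma rooted_tree_image:
  assumes tree: "rooted_tree V r E" and inj: "inj_on g V"
  shows "rooted_tree (g ` V) (g r) (map_prod g g ` E)"
  unfolding rooted_tree_def
proof (intro conjI allI ballI)
  have r: "r \<in> V" and E: "E \<subseteq> V \<times> V" and root: "\<And>u. (u, r) \<notin> E"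
    and parent: "\<And>v. v \<in> V - {r} \<Longrightarrow> \<exists>!u. (u, v) \<in> E"
    and reach: "\<And>v. v \<in> V \<Longrightarrow> (r, v) \<in> E\<^sup>*"
    using tree unfolding rooted_tree_def by auto
  have eqI: "u = v" if "g u = g v" "u \<in> V" "v \<in> V" for u v
    using inj_onD[OF inj] that by blast
  show "g r \<in> g ` V"
    using r by blast
  show "map_prod g g ` E \<subseteq> g ` V \<times> g ` V"
    using E by auto
  show "(x, g r) \<notin> map_prod g g ` E" for x
  proof
    assume "(x, g r) \<in> map_prod g g ` E"
    then obtain u v where "(u, v) \<in> E" "g r = g v"
      by auto
    then show False
      using eqI[of r v] r E root by blast
  qed
  show "\<exists>!x. (x, y) \<in> map_prod g g ` E" if y: "y \<in> g ` V - {g r}" for y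
  proof -
    obtain v where v: "y = g v" "v \<in> V - {r}"
      using y by blast
    obtain u where u: "(u, v) \<in> E" and uniq: "\<And>u'. (u', v) \<in> E \<Longrightarrow> u' = u"
      using parent[OF v(2)] by blast
    show ?thesis
    proof (rule ex1I)
      show "(g u, y) \<in> map_prod g g ` E"
        using u v(1) by force
      fix x assume "(x, y) \<in> map_prod g g ` E"
      then obtain u' v' where u': "(u', v') \<in> E" "x = g u'" "y = g v'"
        by auto
      then have "v' = v"
        using eqI[of v' v] v E by auto
      then show "x = g u"
        using u' uniq by blast
    qed
  qed
  show "(g r, y) \<in> (map_prod g g ` E)\<^sup>*" if "y \<in> g ` V" for y
  proof -
    have "(g r, g v) \<in> (map_prod g g ` E)\<^sup>*" if "(r, v) \<in> E\<^sup>*" for v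
      using that
    proof (induction rule: rtrancl_induct)
      case (step v w)
      have "(g v, g w) \<in> map_prod g g ` E"
        using step.hyps(2) by force
      with step.IH show ?case
        by (rule rtrancl_into_rtrancl)
    qed simp
    then show ?thesis
      using that reach by auto
  qed
qed

lemma kary_tree_image:
  assumes tree: "kary_tree k V r E" and inj: "inj_on g V"
  shows "kary_tree k (g ` V) (g r) (map_prod g g ` E)"
  unfolding kary_tree_def
proof (intro conjI ballI)
  have rooted: "rooted_tree V r E"
    and deg: "\<And>u. u \<in> V \<Longrightarrow> finite (E `` {u}) \<and> card (E `` {u}) \<le> k"
    using tree unfolding kary_tree_def by auto
  have E: "E \<subseteq> V \<times> V"
    using rooted unfolding rooted_tree_def by blast
  show "rooted_tree (g ` V) (g r) (map_prod g g ` E)"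
    by (rule rooted_tree_image[OF rooted inj])
  fix x assume "x \<in> g ` V"
  then obtain u where u: "x = g u" "u \<in> V"
    by blast
  \<comment> \<open>An edge leaving \<open>g u\<close> lifts to an edge leaving \<open>u\<close>
    itself, by injectivity, so relabelling creates no further children and the bound
    \<open>k\<close> survives.\<close>
  have "(map_prod g g ` E) `` {x} = g ` (E `` {u})"
  proof
    show "(map_prod g g ` E) `` {x} \<subseteq> g ` (E `` {u})"
      using u E inj_onD[OF inj] by fastforce
    show "g ` (E `` {u}) \<subseteq> (map_prod g g ` E) `` {x}"
      using u(1) by force
  qed
  then show "finite ((map_prod g g ` E) `` {x})" "card ((map_prod g g ` E) `` {x}) \<le> k"
    using deg[OF u(2)] card_image_le[of "E `` {u}" g] by auto
qed

text \<open>A witnessing tree has vertices of the same type as the elements, and \<open>h\<close>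
  may change that type. The tree is therefore carried over along \<open>h \<circ> f\<close>; its
  vertices are then the image elements themselves and \<open>id\<close> is the bijection.\<close>

lemma kary_chain_image:
  fixes A :: "'a set"
  assumes chain: "kary_chain k lt A" and inj: "inj_on h A"
    and mono: "\<And>x y. x \<in> A \<Longrightarrow> y \<in> A \<Longrightarrow> lt x y \<Longrightarrow> lt' (h x) (h y)"
  shows "kary_chain k lt' (h ` A)"
proof -
  obtain V :: "'a set" and r E f where tree: "kary_tree k V r E" and bij: "bij_betw f V A"
    and lt: "\<And>u v. (u, v) \<in> E\<^sup>+ \<Longrightarrow> lt (f u) (f v)"
    using chain unfolding kary_chain_def by blast
  let ?g = "h \<circ> f" and ?E = "map_prod (h \<circ> f) (h \<circ> f) ` E"
  have fV: "f ` V = A"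
    using bij by (simp add: bij_betw_def)
  have inj_g: "inj_on ?g V"
    using bij inj by (auto simp: bij_betw_def intro: comp_inj_on)
  have E: "E \<subseteq> V \<times> V"
    using tree unfolding kary_tree_def rooted_tree_def by blast
  have "kary_tree k (?g ` V) (?g r) ?E"
    by (rule kary_tree_image[OF tree inj_g])
  moreover have "bij_betw id (?g ` V) (h ` A)"
    using fV by (auto simp: bij_betw_def)
  moreover have "lt' (id x) (id y)" if "(x, y) \<in> ?E\<^sup>+" for x y
  proof -
    obtain u v where uv: "x = ?g u" "y = ?g v" "(u, v) \<in> E\<^sup>+"
      using trancl_map_prod_image[OF inj_g E \<open>(x, y) \<in> ?E\<^sup>+\<close>] by blast
    then have "u \<in> V" "v \<in> V"
      using trancl_subset_Sigma[OF E] by blast+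
    then show ?thesis
      using mono[of "f u" "f v"] lt[OF uv(3)] uv fV by auto
  qed
  ultimately show ?thesis
    unfolding kary_chain_def
    by (intro exI[of _ "?g ` V"] exI[of _ "?g r"] exI[of _ ?E] exI[of _ id]) simp
qed

text \<open>Blocks are mapped one by one. Preservation of the order in one direction suffices, since
  a chain only demands that descendants be larger.\<close>

lemma kary_partition_image:
  assumes part: "partition_on P C" and chains: "\<forall>A\<in>C. kary_chain k lt A"
    and bij: "bij_betw h P P'"
    and mono: "\<And>x y. x \<in> P \<Longrightarrow> y \<in> P \<Longrightarrow> lt x y \<Longrightarrow> lt' (h x) (h y)"
  shows "\<exists>C'. partition_on P' C' \<and> (\<forall>A\<in>C'. kary_chain k lt' A) \<and> card C' = card C"
proof (intro exI conjI)
  have inj: "inj_on h P" and P': "h ` P = P'"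
    using bij by (auto simp: bij_betw_def)
  have sub: "A \<subseteq> P" if "A \<in> C" for A
    using partition_onD1[OF part] that by blast
  \<comment> \<open>Distinct blocks have distinct images because \<open>h\<close> is injective on
    all of \<open>P\<close>, so the number of classes is kept.\<close>
  have "inj_on ((`) h) C"
    using sub inj by (intro inj_onI) (meson inj_on_image_eq_iff)
  then show "card ((`) h ` C) = card C"
    by (rule card_image)
  show "partition_on P' ((`) h ` C)"
  proof -
    \<comment> \<open>\<open>partition_on_inj_image\<close> yields the family of images with the
      empty set removed; blocks are nonempty, so the removal changes nothing.\<close>
    have "{} \<notin> (`) h ` C"
      using partition_onD3[OF part] by auto
    then show ?thesis
      using partition_on_inj_image[OF part inj] P' by simp
  qed
  show "\<forall>A\<in>(`) h ` C. kary_chain k lt' A"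
  proof
    fix B assume "B \<in> (`) h ` C"
    then obtain A where A: "B = h ` A" "A \<in> C"
      by blast
    have "kary_chain k lt' (h ` A)"
    proof (rule kary_chain_image)
      show "kary_chain k lt A"
        using chains A(2) by blast
      show "inj_on h A"
        by (rule inj_on_subset[OF inj sub[OF A(2)]])
      show "lt' (h x) (h y)" if "x \<in> A" "y \<in> A" "lt x y" for x y
        using mono that sub[OF A(2)] by blast
    qed
    then show "kary_chain k lt' B"
      using A(1) by simp
  qed
qed

text \<open>Moving partitions along \<open>h\<close> and along its inverse shows that both posets
  admit exactly the same numbers of classes, hence the same least one.\<close>

lemma k_width_cong_iso:
  assumes bij: "bij_betw h P P'"
    and iso: "\<And>x y. x \<in> P \<Longrightarrow> y \<in> P \<Longrightarrow> lt x y \<longleftrightarrow> lt' (h x) (h y)"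
  shows "k_width k P lt = k_width k P' lt'"
proof -
  let ?h' = "inv_into P h"
  have bij': "bij_betw ?h' P' P"
    by (rule bij_betw_inv_into[OF bij])
  have mono': "lt (?h' x) (?h' y)" if "x \<in> P'" "y \<in> P'" "lt' x y" for x y
    using that iso[of "?h' x" "?h' y"] bij_betw_apply[OF bij']
      bij_betw_inv_into_right[OF bij] by simp
  have "(\<exists>C. partition_on P C \<and> (\<forall>A\<in>C. kary_chain k lt A) \<and> card C = n) \<longleftrightarrow>
    (\<exists>C. partition_on P' C \<and> (\<forall>A\<in>C. kary_chain k lt' A) \<and> card C = n)" (is "?L \<longleftrightarrow> ?R") for n
  proof
    assume ?L
    then obtain C where "partition_on P C" "\<forall>A\<in>C. kary_chain k lt A" "card C = n"
      by blast
    with kary_partition_image[OF this(1,2) bij, of lt'] iso show ?R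
      by simp
  next
    assume ?R
    then obtain C where "partition_on P' C" "\<forall>A\<in>C. kary_chain k lt' A" "card C = n"
      by blast
    with kary_partition_image[OF this(1,2) bij', of lt] mono' show ?L
      by simp
  qed
  then show ?thesis
    unfolding k_width_def by simp
qed

theorem theorem3:
  fixes k :: nat and Q :: "real interval set"
  assumes "k \<ge> 1"
    and "finite Q"
    and "\<forall>I\<in>Q. lower I < upper I"
  shows "k_width k Q below = k_width k (seq_elems (Gr Q)) seq_below"
proof -
  let ?S = "Gr Q"
  have set: "set ?S = Q" and sorted: "sorted_wrt endpoint_less ?S"
    using Gr_properties[OF assms(2)] by auto
  have less: "endpoint_less (?S ! i) (?S ! j)" if "i < j" "j < length ?S" for i j
    using sorted_wrt_nth_less[OF sorted] that by blast
  \<comment> \<open>\<open>endpoint_less\<close> is irreflexive, so the strictly sorted list has no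
    repetitions and dropping the positions merges no entries.\<close>
  have nth_inj: "i = j" if "?S ! i = ?S ! j" "i < length ?S" "j < length ?S" for i j
    using less[of i j] less[of j i] that
    by (cases i j rule: linorder_cases) (auto simp: endpoint_less_def)
  have bij: "bij_betw snd (seq_elems ?S) Q"
    unfolding bij_betw_def
  proof
    show "inj_on snd (seq_elems ?S)"
      by (auto simp: inj_on_def seq_elems_def intro: nth_inj)
    have "snd ` seq_elems ?S = set ?S"
      by (force simp: seq_elems_def set_conv_nth)
    then show "snd ` seq_elems ?S = Q"
      using set by simp
  qed
  have iso: "seq_below x y \<longleftrightarrow> below (snd x) (snd y)"
    if elems: "x \<in> seq_elems ?S" "y \<in> seq_elems ?S" for x y
  proof -
    obtain i j where x: "x = (i, ?S ! i)" "i < length ?S" and y: "y = (j, ?S ! j)" "j < length ?S"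
      using elems by (auto simp: seq_elems_def)
    have "i < j" if "below (?S ! i) (?S ! j)"
    proof (rule ccontr)
      assume "\<not> i < j"
      \<comment> \<open>The case \<open>i = j\<close> is covered by a weak inequality here; the
        strictness for the contradiction comes from
        \<open>lower (?S ! j) < upper (?S ! j)\<close>.\<close>
      then have "upper (?S ! j) \<le> upper (?S ! i)"
        using less[of j i] x(2) by (cases "i = j") (auto simp: endpoint_less_def)
      moreover have "lower (?S ! j) < upper (?S ! j)"
        using assms(3) set nth_mem[OF y(2)] by blast
      ultimately show False
        using that by (simp add: below_def)
    qed
    then show ?thesis
      using x y by (auto simp: seq_below_def)
  qed
  show ?thesis
    by (rule k_width_cong_iso[OF bij, of seq_below below, OF iso, symmetric])
qed

end
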